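(* Let $\Omega$ be a smoothly bounded domain in $\mathbb{C}^n$, and let $\delta$ be the signed distance function to $b\Omega$ (negative in $\Omega$). Suppose that $\mathcal{L}_{\delta(z)}(V,V)\geq 0$ for all $z\in b\Omega$ and all $V\in\mathbb{R}T_z(b\Omega)$. Then there exists a neighborhood $U$ of $b\Omega$ such that $\delta$ is plurisubharmonic on $U\cap\Omega$, i.e., $\mathcal{L}_{\delta(z)}(V,V)\geq 0$ for all $z\in U\cap\Omega$ and all $V\in\mathbb{C}^n$.
   Context: A smoothly bounded domain $\Omega\subset\mathbb{C}^n$ is a bounded domain with smooth ($C^\infty$) boundary $b\Omega$. A local defining function for $\Omega$ in a neighborhood $U$ of $p\in b\Omega$ is a real-valued $r\in C^\infty(U)$ with $U\cap\Omega=\{z\in U: r(z)<0\}$ and $\nabla r(z)\neq 0$ for $z\in U$. Identify $\mathbb{C}^n$ with $\mathbb{R}^{2n}$ via $z_k=x_{2k-1}+i\,x_{2k}$, $k=1,\dots,n$; a vector $(a_1,\dots,a_{2n})\in\mathbb{R}^{2n}$ is identified with $(a_1+ia_2,\dots,a_{2n-1}+ia_{2n})\in\mathbb{C}^n$. The real tangent space to $b\Omega$ at $p\in b\Omega$ is $\mathbb{R}T_p(b\Omega)=\{W\in\mathbb{R}^{2n}:\sum_{k=1}^{2n}\frac{\partial r}{\partial x_k}(p)W_k=0\}$ (independent of the choice of local defining function $r$), regarded as a subset of $\mathbb{C}^n$ through this identification. For a $C^2$ function $f$, the complex Hessian at $p$ is $\mathcal{L}_{f(p)}(A,B)=\sum_{k,\ell=1}^n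 \frac{\partial^2 f}{\partial z_k\partial\bar z_\ell}(p)A_k\overline{B}_\ell$ for $A,B\in\mathbb{C}^n$. The signed distance function is $\delta(z)=-d(z)$ for $z\in\Omega$ and $\delta(z)=d(z)$ for $z\in\mathbb{C}^n\setminus\Omega$, where $d(z)=\inf_{q\in b\Omega}\|z-q\|$ is the Euclidean distance to $b\Omega$. It is smooth in some neighborhood of $b\Omega$. *)

theory Defs
  imports "HOL-Analysis.Analysis" "HOL-Library.Complex_Order"
begin

(* C^n is the type complex ^ 'n.  As a real inner product space it is R^(2n): the norm is the
   Euclidean one, and its standard real basis consists of the vectors axis k 1 (direction
   x_(2k-1)) and axis k i (direction x_(2k)). *)

(* Classical C^k on an open set S: in finite dimension, f is C^(k+1) iff it is differentiable
   and all its directional derivatives are C^k. *)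
primrec Ck_on :: "nat \<Rightarrow> ('a::euclidean_space \<Rightarrow> 'b::real_normed_vector) \<Rightarrow> 'a set \<Rightarrow> bool" where
  "Ck_on 0 f S \<longleftrightarrow> continuous_on S f"
| "Ck_on (Suc k) f S \<longleftrightarrow>
     (\<forall>x\<in>S. f differentiable (at x)) \<and> (\<forall>v. Ck_on k (\<lambda>x. frechet_derivative f (at x) v) S)"

definition smooth_on :: "('a::euclidean_space \<Rightarrow> 'b::real_normed_vector) \<Rightarrow> 'a set \<Rightarrow> bool" where
  "smooth_on f S \<longleftrightarrow> (\<forall>k. Ck_on k f S)"

definition partial_x :: "'n \<Rightarrow> (complex ^ 'n \<Rightarrow> 'b::real_normed_vector) \<Rightarrow> complex ^ 'n \<Rightarrow> 'b" where
  "partial_x k f z = frechet_derivative f (at z) (axis k 1)"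

definition partial_y :: "'n \<Rightarrow> (complex ^ 'n \<Rightarrow> 'b::real_normed_vector) \<Rightarrow> complex ^ 'n \<Rightarrow> 'b" where
  "partial_y k f z = frechet_derivative f (at z) (axis k \<i>)"

definition partial_z :: "'n \<Rightarrow> (complex ^ 'n \<Rightarrow> complex) \<Rightarrow> complex ^ 'n \<Rightarrow> complex" where
  "partial_z k f z = (partial_x k f z - \<i> * partial_y k f z) / 2"

definition partial_zbar :: "'n \<Rightarrow> (complex ^ 'n \<Rightarrow> complex) \<Rightarrow> complex ^ 'n \<Rightarrow> complex" where
  "partial_zbar k f z = (partial_x k f z + \<i> * partial_y k f z) / 2"

definition complex_hessian ::
  "(complex ^ 'n \<Rightarrow> real) \<Rightarrow> complex ^ 'n \<Rightarrow> complex ^ 'n \<Rightarrow> complex ^ 'n \<Rightarrow> complex" where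
  "complex_hessian f p A B =
     (\<Sum>k\<in>UNIV. \<Sum>l\<in>UNIV.
        partial_z k (partial_zbar l (\<lambda>z. complex_of_real (f z))) p * (A $ k) * cnj (B $ l))"

definition local_defining_function ::
  "(complex ^ 'n) set \<Rightarrow> complex ^ 'n \<Rightarrow> (complex ^ 'n) set \<Rightarrow> (complex ^ 'n \<Rightarrow> real) \<Rightarrow> bool" where
  "local_defining_function \<Omega> p U r \<longleftrightarrow>
     open U \<and> p \<in> U \<and> smooth_on r U \<and> U \<inter> \<Omega> = {z \<in> U. r z < 0} \<and>
     (\<forall>z\<in>U. \<exists>k. partial_x k r z \<noteq> 0 \<or> partial_y k r z \<noteq> 0)"

definition smoothly_bounded_domain :: "(complex ^ 'n) set \<Rightarrow> bool" where
  "smoothly_bounded_domain \<Omega> \<longleftrightarrow>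
     open \<Omega> \<and> connected \<Omega> \<and> \<Omega> \<noteq> {} \<and> bounded \<Omega> \<and>
     (\<forall>p\<in>frontier \<Omega>. \<exists>U r. local_defining_function \<Omega> p U r)"

(* The condition on W does not depend on the choice of the local defining function. *)
definition real_tangent_space :: "(complex ^ 'n) set \<Rightarrow> complex ^ 'n \<Rightarrow> (complex ^ 'n) set" where
  "real_tangent_space \<Omega> p =
     {W. \<exists>U r. local_defining_function \<Omega> p U r \<and>
        (\<Sum>k\<in>UNIV. partial_x k r p * Re (W $ k) + partial_y k r p * Im (W $ k)) = 0}"

definition signed_distance :: "(complex ^ 'n) set \<Rightarrow> complex ^ 'n \<Rightarrow> real" where
  "signed_distance \<Omega> z =
     (if z \<in> \<Omega> then - infdist z (frontier \<Omega>) else infdist z (frontier \<Omega>))"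

(* Plurisubharmonicity of C^2 functions on an open set.  The order on complex is the one of
   Complex_Order: 0 \<le> w means that w is real and nonnegative. *)
definition plurisubharmonic_on :: "(complex ^ 'n \<Rightarrow> real) \<Rightarrow> (complex ^ 'n) set \<Rightarrow> bool" where
  "plurisubharmonic_on f S \<longleftrightarrow>
     Ck_on 2 f S \<and> (\<forall>z\<in>S. \<forall>V. 0 \<le> complex_hessian f z V V)"

end

theory Submission
  imports Defs
begin

text \<open>
  The complex Hessian satisfies \<open>L(cV, cV) = L(V, V)\<close> for \<open>\<bar>c\<bar> = 1\<close>, and every complex vector can be
  rotated by such a \<open>c\<close> into the real tangent space. So the hypothesis already gives
  \<open>L(V, V) \<ge> 0\<close> at boundary points for all complex vectors \<open>V\<close>.

  To move inside, let \<open>q\<close> be a boundary point nearest to \<open>z \<in> \<Omega>\<close>. Since \<open>\<delta>\<close> is 1-Lipschitz,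
  \<open>\<delta>(z + h) \<ge> \<delta>(q + h) + \<delta>(z)\<close> for all \<open>h\<close>, with equality at \<open>h = 0\<close>. Hence the real Hessian
  of \<open>\<delta>\<close> at \<open>z\<close> dominates the one at \<open>q\<close>, and as \<open>4 L(V, V) = H(V, V) + H(iV, iV)\<close> the same holds
  for the complex Hessians.

  That \<open>\<delta>\<close> is \<open>C\<^sup>2\<close> near the boundary follows from the inverse function theorem, applied to
  \<open>(x, \<mu>) \<mapsto> (x + \<mu> \<nabla>r(x), r(x))\<close>: a boundary point \<open>q\<close> nearest to \<open>z\<close> satisfies
  \<open>z = q + \<mu> \<nabla>r(q)\<close> and \<open>\<delta>(z) = \<mu> \<bar>\<nabla>r(q)\<bar>\<close>, so \<open>(q, \<mu>)\<close> is the preimage of \<open>(z, 0)\<close> and depends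
  on \<open>z\<close> in a \<open>C\<^sup>1\<close> way, and the gradient of \<open>\<delta>\<close> at \<open>z\<close> is \<open>\<nabla>r(q) / \<bar>\<nabla>r(q)\<bar>\<close>.
\<close>

section \<open>The complex Hessian\<close>

lemma linear_vec_expansion:
  fixes L :: "complex ^ 'n \<Rightarrow> 'b::real_vector"
  assumes "linear L"
  shows "L V = (\<Sum>k\<in>UNIV. Re (V $ k) *\<^sub>R L (axis k 1) + Im (V $ k) *\<^sub>R L (axis k \<i>))"
proof -
  have "V = (\<Sum>k\<in>UNIV. Re (V $ k) *\<^sub>R axis k 1 + Im (V $ k) *\<^sub>R axis k \<i>)"
    by (simp add: vec_eq_iff axis_def if_distrib[where f="(*\<^sub>R) _"] complex_eq_iff
        sum.distrib cong: if_cong)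
  then have "L V = L (\<Sum>k\<in>UNIV. Re (V $ k) *\<^sub>R axis k 1 + Im (V $ k) *\<^sub>R axis k \<i>)"
    by simp
  then show ?thesis
    using assms by (simp add: linear_sum linear_add linear_scale)
qed

text \<open>Under the identification of C^n with R^(2n) the entry \<open>n z $ l\<close> is f_x + i
  f_y in the l-th coordinate, so \<open>partial_zbar l\<close> is half of it and the Hessian becomes
  a contraction of \<open>n'\<close>. The imaginary part is left as an antisymmetric expression; it
  vanishes once \<open>n'\<close> is known to be symmetric.\<close>

lemma complex_hessian_eq_Complex:
  fixes f :: "complex ^ 'n \<Rightarrow> real"
  assumes "open W" "p \<in> W"
    and f: "\<And>z. z \<in> W \<Longrightarrow> (f has_derivative (\<lambda>h. n z \<bullet> h)) (at z)"
    and n: "(n has_derivative n') (at p)"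
  shows "complex_hessian f p V V =
    Complex ((n' V \<bullet> V + n' (\<i> *s V) \<bullet> (\<i> *s V)) / 4) ((n' V \<bullet> (\<i> *s V) - n' (\<i> *s V) \<bullet> V) / 4)"
proof -
  have lin: "linear n'"
    using n has_derivative_linear by blast
  have zbar: "partial_zbar l (\<lambda>z. complex_of_real (f z)) z = n z $ l / 2" if "z \<in> W" for z l
  proof -
    have "((\<lambda>z. complex_of_real (f z)) has_derivative (\<lambda>h. complex_of_real (n z \<bullet> h))) (at z)"
      by (intro derivative_intros f that)
    from frechet_derivative_at[OF this, symmetric] show ?thesis
      by (simp add: partial_zbar_def partial_x_def partial_y_def inner_axis inner_complex_def
          complex_eq_iff)
  qed
  have z: "partial_z k (partial_zbar l (\<lambda>z. complex_of_real (f z))) p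
      = (n' (axis k 1) $ l - \<i> * n' (axis k \<i>) $ l) / 4" for k l
  proof -
    have "((\<lambda>z. n z $ l / 2) has_derivative (\<lambda>h. n' h $ l / 2)) (at p)"
      using bounded_linear.has_derivative[OF bounded_linear_divide
          bounded_linear.has_derivative[OF bounded_linear_vec_nth n]] .
    then have "(partial_zbar l (\<lambda>z. complex_of_real (f z)) has_derivative (\<lambda>h. n' h $ l / 2)) (at p)"
      by (rule has_derivative_transform_within_open[OF _ assms(1,2)]) (simp add: zbar)
    from frechet_derivative_at[OF this, symmetric] show ?thesis
      by (simp add: partial_z_def partial_x_def partial_y_def)
  qed
  define u where "u = n' V"
  define v where "v = n' (\<i> *s V)"
  \<comment> \<open>The left side is the complex-linear extension of d/dx - i d/dy; in terms of
    \<open>n'\<close> it is \<open>n' V - \<i> * n' (\<i> *s V)\<close>, twice the complex-linear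
    part of \<open>n'\<close>.\<close>
  have uv: "(\<Sum>k\<in>UNIV. (n' (axis k 1) $ l - \<i> * n' (axis k \<i>) $ l) * V $ k)
     = u $ l - \<i> * v $ l" for l
    unfolding u_def v_def linear_vec_expansion[OF lin, of V]
      linear_vec_expansion[OF lin, of "\<i> *s V"]
    by (simp add: complex_eq_iff sum.distrib algebra_simps sum_subtractf sum_negf)
  have "complex_hessian f p V V = (\<Sum>l\<in>UNIV. \<Sum>k\<in>UNIV.
      (n' (axis k 1) $ l - \<i> * n' (axis k \<i>) $ l) * V $ k * cnj (V $ l) / 4)"
    unfolding complex_hessian_def z by (subst sum.swap) simp
  also have "\<dots> = (\<Sum>l\<in>UNIV. (u $ l - \<i> * v $ l) * cnj (V $ l)) / 4"
    by (simp add: uv[symmetric] sum_divide_distrib sum_distrib_right)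
  also have "\<dots> = Complex ((u \<bullet> V + v \<bullet> (\<i> *s V)) / 4) ((u \<bullet> (\<i> *s V) - v \<bullet> V) / 4)"
    by (simp add: complex_eq_iff inner_vec_def inner_complex_def sum.distrib[symmetric] sum_subtractf[symmetric]
       algebra_simps sum_negf[symmetric])
  finally show ?thesis
    by (simp add: u_def v_def)
qed

lemma complex_hessian_rotate:
  assumes "norm c = 1"
  shows "complex_hessian f p (c *s V) (c *s V) = complex_hessian f p V V"
proof -
  have "c * cnj c = 1"
    using assms by (simp flip: complex_norm_square)
  then have "x * (c * a) * (cnj c * b) = x * a * b" for x a b
    by (metis mult.assoc mult.commute mult.right_neutral)
  then show ?thesis
    unfolding complex_hessian_def vector_smult_component complex_cnj_mult by presburger
qed

text \<open>On the complex line through \<open>V\<close>, \<open>l\<close> is a real functional of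
  \<open>c\<close> with coefficients \<open>a\<close> and \<open>b\<close>. It kills the direction
  \<open>Complex b (- a)\<close>, which is then normalised; if that vector is zero, \<open>l\<close>
  vanishes on the whole line and \<open>c = 1\<close> serves.\<close>

lemma unit_rotation_into_kernel:
  fixes l :: "complex ^ 'n \<Rightarrow> real"
  assumes "linear l"
  obtains c where "norm c = 1" "l (c *s V) = 0"
proof -
  define a b where "a = l V" and "b = l (\<i> *s V)"
  have l: "l (c *s V) = Re c * a + Im c * b" for c
  proof -
    have "c *s V = Re c *\<^sub>R V + Im c *\<^sub>R (\<i> *s V)"
      by (simp add: vec_eq_iff complex_eq_iff)
    then show ?thesis
      using assms by (simp add: linear_add linear_scale a_def b_def)
  qed
  show thesis
  proof (cases "Complex b (- a) = 0")
    case True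
    then have "l (1 *s V) = 0"
      unfolding l by (simp add: complex_eq_iff)
    with that[of 1] show thesis by simp
  next
    case False
    have "l (sgn (Complex b (- a)) *s V) = 0"
      by (simp add: l complex_sgn_def field_simps)
    with that[of "sgn (Complex b (- a))"] False show thesis
      by (simp add: norm_sgn)
  qed
qed

section \<open>Second derivatives\<close>

lemma has_real_derivative_along_line:
  fixes f :: "'a::real_normed_vector \<Rightarrow> real"
  assumes "(f has_derivative f') (at (x + t *\<^sub>R v))"
  shows "((\<lambda>s. f (x + s *\<^sub>R v)) has_real_derivative f' v) (at t)"
proof -
  have "((\<lambda>s. x + s *\<^sub>R v) has_derivative (\<lambda>s. s *\<^sub>R v)) (at t)"
    by (auto intro!: derivative_eq_intros)
  from has_derivative_compose[OF this assms]
  have "((\<lambda>s. f (x + s *\<^sub>R v)) has_derivative (\<lambda>s. s *\<^sub>R f' v)) (at t)"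
    using has_derivative_linear[OF assms] by (simp add: linear_scale)
  then show ?thesis
    by (simp add: has_field_derivative_def mult_commute_abs)
qed

text \<open>If \<open>c\<close> were negative, \<open>\<phi>'\<close> would vanish at 0 and be
  negative just to the right of it, and the mean value theorem would push \<open>\<phi>\<close>
  below its minimum.\<close>

lemma local_min_second_derivative_nonneg:
  fixes \<phi> :: "real \<Rightarrow> real"
  assumes "e > 0"
    and d1: "\<And>s. \<bar>s\<bar> < e \<Longrightarrow> (\<phi> has_real_derivative \<phi>' s) (at s)"
    and d2: "(\<phi>' has_real_derivative c) (at 0)"
    and min: "\<And>s. \<bar>s\<bar> < e \<Longrightarrow> \<phi> 0 \<le> \<phi> s"
  shows "c \<ge> 0"
proof (rule ccontr)
  assume "\<not> c \<ge> 0"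
  have "\<phi>' 0 = 0"
    by (rule DERIV_local_min[OF d1 \<open>e > 0\<close>]) (use \<open>e > 0\<close> min in auto)
  moreover obtain d where "d > 0" and d: "\<And>h. 0 < h \<Longrightarrow> h < d \<Longrightarrow> \<phi>' (0 + h) < \<phi>' 0"
    using DERIV_neg_dec_right[OF d2] \<open>\<not> c \<ge> 0\<close> by auto
  ultimately have neg: "\<phi>' h < 0" if "0 < h" "h < d" for h
    using that by force
  define s where "s = min d e / 2"
  have s: "0 < s" "s < d" "s < e"
    using \<open>d > 0\<close> \<open>e > 0\<close> by (auto simp: s_def)
  then obtain x where "0 < x" "x < s" "\<phi> s - \<phi> 0 = (s - 0) * \<phi>' x"
    using MVT2[of 0 s \<phi> \<phi>'] d1 by auto
  then have "\<phi> s < \<phi> 0"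
    using neg[of x] s by (smt (verit) mult_pos_neg)
  then show False
    using min[of s] s by simp
qed

text \<open>The rectangle \<open>f (p + h a + h b) - f (p + h a) - f (p + h b) + f p\<close> is symmetric in
  \<open>a\<close> and \<open>b\<close>, and its quotient by \<open>h\<^sup>2\<close> tends to \<open>n' b \<bullet> a\<close>.\<close>

lemma gradient_derivative_symmetric:
  fixes f :: "'a::real_inner \<Rightarrow> real"
  assumes "open W" "p \<in> W"
    and f: "\<And>z. z \<in> W \<Longrightarrow> (f has_derivative (\<lambda>h. n z \<bullet> h)) (at z)"
    and n: "(n has_derivative n') (at p)"
  shows "n' a \<bullet> b = n' b \<bullet> a"
proof -
  define R where "R h = f (p + h *\<^sub>R a + h *\<^sub>R b) - f (p + h *\<^sub>R a) - f (p + h *\<^sub>R b) + f p" for h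
  have lin: "linear n'"
    using n has_derivative_linear by blast
  \<comment> \<open>The estimate is stated for arbitrary \<open>a\<close> and \<open>b\<close>
    because it is used twice, the second time with the two directions interchanged.\<close>
  have key: "\<exists>h0>0. \<forall>h. 0 < h \<and> h < h0 \<longrightarrow>
      \<bar>f (p + h *\<^sub>R a + h *\<^sub>R b) - f (p + h *\<^sub>R a) - f (p + h *\<^sub>R b) + f p - h\<^sup>2 * (n' b \<bullet> a)\<bar> \<le> e * h\<^sup>2"
    if "e > 0" for e :: real and a b :: 'a
  proof -
    \<comment> \<open>The whole parallelogram with sides \<open>h *\<^sub>R a\<close> and
      \<open>h *\<^sub>R b\<close> lies within \<open>h * C\<close> of \<open>p\<close>. With this
      \<open>e'\<close>, two remainders of size \<open>e' * (h * C)\<close>, paired with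
      \<open>a\<close>, add up to at most \<open>e * h\<close>.\<close>
    define C where "C = norm a + norm b + 1"
    define e' where "e' = e / (2 * C * C)"
    have C: "C > 0" "norm a \<le> C" "norm b \<le> C" "norm a + norm b < C"
      using norm_ge_zero[of a] norm_ge_zero[of b] by (auto simp: C_def intro: add_nonneg_pos)
    have "e' > 0"
      using C that by (simp add: e'_def)
    from n[unfolded has_derivative_at_alt] \<open>e' > 0\<close> obtain d where "d > 0"
      and d: "\<And>y. norm (y - p) < d \<Longrightarrow> norm (n y - n p - n' (y - p)) \<le> e' * norm (y - p)"
      by blast
    obtain r where "r > 0" and r: "ball p r \<subseteq> W"
      using assms(1,2) openE by blast
    define h0 where "h0 = min d r / C"
    have "h0 > 0"
      using \<open>d > 0\<close> \<open>r > 0\<close> C by (simp add: h0_def)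
    moreover have "\<bar>f (p + h *\<^sub>R a + h *\<^sub>R b) - f (p + h *\<^sub>R a) - f (p + h *\<^sub>R b) + f p - h\<^sup>2 * (n' b \<bullet> a)\<bar> \<le> e * h\<^sup>2"
      if h: "0 < h" "h < h0" for h
    proof -
      have hC: "h * C < d" "h * C < r"
        using h C by (simp_all add: h0_def field_simps)
      have small: "norm (s *\<^sub>R a + t *\<^sub>R b) \<le> h * C" if "0 \<le> s" "s \<le> h" "0 \<le> t" "t \<le> h" for s t
      proof -
        have "norm (s *\<^sub>R a + t *\<^sub>R b) \<le> s * norm a + t * norm b"
          using that norm_triangle_ineq[of "s *\<^sub>R a" "t *\<^sub>R b"] by simp
        also have "\<dots> \<le> h * norm a + h * norm b"
          using that by (intro add_mono mult_right_mono) auto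
        also have "\<dots> \<le> h * C"
          using h C by (simp add: distrib_left[symmetric])
        finally show ?thesis .
      qed
      \<comment> \<open>The rectangle is an increment of \<open>\<psi>\<close>, so the mean value
        theorem in direction \<open>a\<close> turns it into a difference of \<open>n\<close> across
        the side \<open>b\<close>; the remainder \<open>E\<close> of \<open>n\<close> at
        \<open>p\<close> controls that difference.\<close>
      define \<psi> where "\<psi> s = f ((p + h *\<^sub>R b) + s *\<^sub>R a) - f (p + s *\<^sub>R a)" for s
      have W: "p + s *\<^sub>R a + t *\<^sub>R b \<in> W" if "0 \<le> s" "s \<le> h" "0 \<le> t" "t \<le> h" for s t
        using small[OF that] hC r by (auto simp: dist_norm algebra_simps norm_minus_commute intro!: subsetD[OF r])
      have D: "(\<psi> has_real_derivative (n (p + h *\<^sub>R b + s *\<^sub>R a) \<bullet> a - n (p + s *\<^sub>R a) \<bullet> a)) (at s)"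
        if "0 \<le> s" "s \<le> h" for s
      proof -
        have "p + h *\<^sub>R b + s *\<^sub>R a \<in> W" "p + s *\<^sub>R a \<in> W"
          using W[of s h] W[of s 0] that h by (simp_all add: algebra_simps)
        from DERIV_diff[OF f[OF this(1), THEN has_real_derivative_along_line]
          f[OF this(2), THEN has_real_derivative_along_line]]
        show ?thesis
          unfolding \<psi>_def .
      qed
      obtain s where s: "0 < s" "s < h"
        and eq: "\<psi> h - \<psi> 0 = (h - 0) * (n (p + h *\<^sub>R b + s *\<^sub>R a) \<bullet> a - n (p + s *\<^sub>R a) \<bullet> a)"
        using MVT2[OF \<open>0 < h\<close> D] by metis
      define E where "E y = n y - n p - n' (y - p)" for y
      have E: "norm (E (p + s *\<^sub>R a + t *\<^sub>R b)) \<le> e' * (h * C)" if "0 \<le> t" "t \<le> h" for t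
      proof -
        have sm: "norm ((p + s *\<^sub>R a + t *\<^sub>R b) - p) \<le> h * C"
          using small[of s t] that s by (simp add: algebra_simps)
        then have "norm (E (p + s *\<^sub>R a + t *\<^sub>R b)) \<le> e' * norm ((p + s *\<^sub>R a + t *\<^sub>R b) - p)"
          unfolding E_def using hC by (intro d) auto
        also have "\<dots> \<le> e' * (h * C)"
          using sm \<open>e' > 0\<close> by (intro mult_left_mono) auto
        finally show ?thesis .
      qed
      have "n (p + s *\<^sub>R a + h *\<^sub>R b) - n (p + s *\<^sub>R a) = h *\<^sub>R n' b
          + (E (p + s *\<^sub>R a + h *\<^sub>R b) - E (p + s *\<^sub>R a + 0 *\<^sub>R b))"
        using lin by (simp add: E_def linear_add linear_scale linear_diff algebra_simps)
      then have "(n (p + h *\<^sub>R b + s *\<^sub>R a) \<bullet> a - n (p + s *\<^sub>R a) \<bullet> a) - h * (n' b \<bullet> a)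
        = (E (p + s *\<^sub>R a + h *\<^sub>R b) - E (p + s *\<^sub>R a + 0 *\<^sub>R b)) \<bullet> a"
        by (simp add: inner_diff_left[symmetric] inner_scaleR_left[symmetric] add_ac del: inner_scaleR_left)
      also have "\<bar>\<dots>\<bar> \<le> norm (E (p + s *\<^sub>R a + h *\<^sub>R b) - E (p + s *\<^sub>R a + 0 *\<^sub>R b)) * norm a"
        by (rule Cauchy_Schwarz_ineq2)
      also have "\<dots> \<le> (e' * (h * C) + e' * (h * C)) * C"
        using E[of h] E[of 0] h C \<open>e' > 0\<close>
        by (intro mult_mono order_trans[OF norm_triangle_ineq4] add_mono) auto
      also have "\<dots> = e * h"
        using C by (simp add: e'_def field_simps)
      finally have "\<bar>(n (p + h *\<^sub>R b + s *\<^sub>R a) \<bullet> a - n (p + s *\<^sub>R a) \<bullet> a) - h * (n' b \<bullet> a)\<bar> \<le> e * h" .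
      then have "h * \<bar>(n (p + h *\<^sub>R b + s *\<^sub>R a) \<bullet> a - n (p + s *\<^sub>R a) \<bullet> a) - h * (n' b \<bullet> a)\<bar> \<le> h * (e * h)"
        using h by (intro mult_left_mono) auto
      moreover have "(\<psi> h - \<psi> 0) - h\<^sup>2 * (n' b \<bullet> a)
          = h * ((n (p + h *\<^sub>R b + s *\<^sub>R a) \<bullet> a - n (p + s *\<^sub>R a) \<bullet> a) - h * (n' b \<bullet> a))"
        unfolding eq by (simp add: power2_eq_square right_diff_distrib)
      ultimately have "\<bar>(\<psi> h - \<psi> 0) - h\<^sup>2 * (n' b \<bullet> a)\<bar> \<le> e * h\<^sup>2"
        using h by (simp add: abs_mult power2_eq_square mult.left_commute)
      then show ?thesis
        by (simp add: \<psi>_def algebra_simps)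
    qed
    ultimately show ?thesis by blast
  qed
  have R_swap: "R h = f (p + h *\<^sub>R b + h *\<^sub>R a) - f (p + h *\<^sub>R b) - f (p + h *\<^sub>R a) + f p" for h
    by (simp add: R_def add_ac)
  have "\<bar>n' a \<bullet> b - n' b \<bullet> a\<bar> \<le> e" if e: "e > 0" for e
  proof -
    obtain h1 where h1: "h1 > 0" "\<And>h. 0 < h \<Longrightarrow> h < h1 \<Longrightarrow> \<bar>R h - h\<^sup>2 * (n' b \<bullet> a)\<bar> \<le> e / 2 * h\<^sup>2"
      using key[OF half_gt_zero[OF e], of a b] unfolding R_def by metis
    obtain h2 where h2: "h2 > 0" "\<And>h. 0 < h \<Longrightarrow> h < h2 \<Longrightarrow> \<bar>R h - h\<^sup>2 * (n' a \<bullet> b)\<bar> \<le> e / 2 * h\<^sup>2"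
      using key[OF half_gt_zero[OF e], of b a] unfolding R_swap by metis
    define h where "h = min h1 h2 / 2"
    have h: "0 < h" "h < h1" "h < h2"
      using h1 h2 by (auto simp: h_def)
    have "\<bar>h\<^sup>2 * (n' a \<bullet> b) - h\<^sup>2 * (n' b \<bullet> a)\<bar> \<le> h\<^sup>2 * e"
    proof -
      have "e / 2 * h\<^sup>2 + e / 2 * h\<^sup>2 = h\<^sup>2 * e"
        by simp
      then show ?thesis
        using h1(2)[of h] h2(2)[of h] h by linarith
    qed
    then have "h\<^sup>2 * \<bar>n' a \<bullet> b - n' b \<bullet> a\<bar> \<le> h\<^sup>2 * e"
      by (simp add: right_diff_distrib[symmetric] abs_mult)
    then show ?thesis
      using h by simp
  qed
  then show ?thesis
    using field_le_epsilon[of "\<bar>n' a \<bullet> b - n' b \<bullet> a\<bar>" 0] by simp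
qed

section \<open>The signed distance and its nearest points\<close>

lemma crossing_frontier:
  fixes a b :: "'a::euclidean_space"
  assumes "a \<in> S" "b \<notin> S"
  obtains c where "c \<in> frontier S" "dist a c + dist c b = dist a b"
proof -
  have "closed_segment a b \<inter> frontier S \<noteq> {}"
    using assms by (intro connected_Int_frontier) auto
  then obtain c where "c \<in> closed_segment a b" "c \<in> frontier S"
    by blast
  then show thesis
    using that by (metis between between_mem_segment)
qed

text \<open>The points lie on opposite sides of \<open>S\<close>, so the segment between them
  crosses the frontier, and the crossing point competes in both infima.\<close>

lemma infdist_frontier_le:
  fixes a b :: "'a::euclidean_space"
  assumes "a \<in> S \<longleftrightarrow> b \<notin> S"
  shows "infdist a (frontier S) + infdist b (frontier S) \<le> dist a b"
proof -
  have *: "infdist x (frontier S) + infdist y (frontier S) \<le> dist x y"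
    if xy: "x \<in> S" "y \<notin> S" for x y
  proof -
    obtain c where "c \<in> frontier S" "dist x c + dist c y = dist x y"
      using xy by (rule crossing_frontier)
    then show ?thesis
      using infdist_le[of c "frontier S" x] infdist_le[of c "frontier S" y] by (simp add: dist_commute)
  qed
  show ?thesis
    using assms *[of a b] *[of b a] by (auto simp: dist_commute)
qed

text \<open>On one side of \<open>S\<close> this is the Lipschitz bound for \<open>infdist\<close>.
  On opposite sides the signed distances differ by the sum of the two distances, which the segment
  crossing bounds.\<close>

lemma signed_distance_lipschitz:
  "\<bar>signed_distance S a - signed_distance S b\<bar> \<le> dist a b"
proof (cases "a \<in> S \<longleftrightarrow> b \<in> S")
  case True
  then show ?thesis
    using infdist_triangle_abs[of a "frontier S" b] by (auto simp: signed_distance_def)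
next
  case False
  then show ?thesis
    using infdist_frontier_le[of a S b] infdist_nonneg[of a "frontier S"] infdist_nonneg[of b "frontier S"]
    by (auto simp: signed_distance_def)
qed

text \<open>The points \<open>q + h\<close> and \<open>z + h\<close> are at distance
  \<open>dist z q\<close>, which is \<open>- signed_distance S z\<close>, so the Lipschitz bound
  applies. At \<open>h = 0\<close> equality holds, which makes this a second-order
  comparison.\<close>

lemma signed_distance_translate_ge:
  assumes "z \<in> S" "q \<in> frontier S" "infdist z (frontier S) = dist z q"
  shows "signed_distance S (q + h) + signed_distance S z \<le> signed_distance S (z + h)"
  using signed_distance_lipschitz[of S "q + h" "z + h"] assms
  by (simp add: signed_distance_def dist_commute)

text \<open>A Lagrange multiplier rule with sign: near \<open>q\<close> the open ball about
  \<open>z\<close> through \<open>q\<close> lies in \<open>r \<le> 0\<close>, so \<open>g\<close>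
  points out of the ball at \<open>q\<close>, opposite to \<open>z - q\<close>.\<close>

lemma nearest_point_multiplier:
  fixes g q z :: "'a::real_inner"
  assumes r: "(r has_derivative (\<lambda>h. g \<bullet> h)) (at q)"
    and "r q = 0" "open U" "q \<in> U" "g \<noteq> 0" "z \<noteq> q"
    and neg: "\<And>y. y \<in> U \<Longrightarrow> dist z y < dist z q \<Longrightarrow> r y \<le> (0::real)"
  obtains \<mu> where "\<mu> < 0" "z - q = \<mu> *\<^sub>R g"
proof -
  \<comment> \<open>Such a \<open>w\<close> enters the ball at \<open>q\<close>; if
    \<open>g \<bullet> w\<close> were positive, \<open>r\<close> would become positive along it
    while still inside the ball.\<close>
  have half: "g \<bullet> w \<le> 0" if w: "w \<bullet> (z - q) > 0" for w
  proof (rule ccontr)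
    assume "\<not> g \<bullet> w \<le> 0"
    have "((\<lambda>s. r (q + s *\<^sub>R w)) has_real_derivative g \<bullet> w) (at 0)"
      by (rule has_real_derivative_along_line) (use r in simp)
    from DERIV_pos_inc_right[OF this] \<open>\<not> g \<bullet> w \<le> 0\<close> obtain d where "d > 0"
      and d: "\<And>h. 0 < h \<Longrightarrow> h < d \<Longrightarrow> r (q + h *\<^sub>R w) > 0"
      using \<open>r q = 0\<close> by auto
    have "\<forall>\<^sub>F s in at_right (0::real). q + s *\<^sub>R w \<in> U"
    proof -
      have "((\<lambda>s. q + s *\<^sub>R w) \<longlongrightarrow> q + 0 *\<^sub>R w) (at_right 0)"
        by (intro tendsto_intros)
      then show ?thesis
        by (rule topological_tendstoD) (use assms in auto)
    qed
    moreover have "\<forall>\<^sub>F s in at_right (0::real). s * (w \<bullet> w) < 2 * (w \<bullet> (z - q))"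
    proof -
      have "((\<lambda>s. s * (w \<bullet> w)) \<longlongrightarrow> 0 * (w \<bullet> w)) (at_right 0)"
        by (intro tendsto_intros)
      from order_tendstoD(2)[OF this, of "2 * (w \<bullet> (z - q))"] w show ?thesis by simp
    qed
    moreover have "\<forall>\<^sub>F s in at_right (0::real). s \<in> {0<..<d}"
      using \<open>d > 0\<close> by (rule eventually_at_right_real)
    ultimately have "\<forall>\<^sub>F s in at_right (0::real). False"
    proof eventually_elim
      case (elim s)
      have "(dist z (q + s *\<^sub>R w))\<^sup>2 = (dist z q)\<^sup>2 + s * (s * (w \<bullet> w) - 2 * (w \<bullet> (z - q)))"
        by (simp add: dist_norm power2_norm_eq_inner inner_simps algebra_simps inner_commute)
      also have "\<dots> < (dist z q)\<^sup>2"
        using elim by (simp add: mult_less_0_iff)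
      finally have "dist z (q + s *\<^sub>R w) < dist z q"
        by (rule power2_less_imp_less) simp
      with neg[of "q + s *\<^sub>R w"] d[of s] elim show False by auto
    qed
    then show False by simp
  qed
  define u where "u = z - q"
  have u: "u \<bullet> u > 0"
    using \<open>z \<noteq> q\<close> by (simp add: u_def)
  \<comment> \<open>The component of \<open>g\<close> orthogonal to \<open>u\<close>. It lies only
    on the edge of the half space covered by \<open>half\<close>, so it is approached by
    \<open>w + e *\<^sub>R u\<close> with \<open>e\<close> tending to 0; then
    \<open>w \<bullet> w = g \<bullet> w \<le> 0\<close> forces \<open>w = 0\<close>.\<close>
  define w where "w = g - ((g \<bullet> u) / (u \<bullet> u)) *\<^sub>R u"
  have wu: "w \<bullet> u = 0"
    using u by (simp add: w_def inner_diff_left)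
  have "g \<bullet> w \<le> 0"
  proof -
    have "g \<bullet> (w + e *\<^sub>R u) \<le> 0" if "e > 0" for e
      using that u wu by (intro half) (simp add: inner_add_left flip: u_def)
    then have "\<forall>\<^sub>F e in at_right 0. g \<bullet> (w + e *\<^sub>R u) \<le> 0"
      by (auto simp: eventually_at_filter)
    moreover have "((\<lambda>e. g \<bullet> (w + e *\<^sub>R u)) \<longlongrightarrow> g \<bullet> (w + 0 *\<^sub>R u)) (at_right 0)"
      by (intro tendsto_intros)
    ultimately show ?thesis
      using tendsto_upperbound[of "\<lambda>e. g \<bullet> (w + e *\<^sub>R u)" _ "at_right 0" 0] by simp
  qed
  moreover have "w \<bullet> w = g \<bullet> w"
    using wu by (simp add: w_def inner_diff_left inner_diff_right inner_commute)
  ultimately have "w = 0"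
    by (metis inner_ge_zero inner_eq_zero_iff order_antisym)
  then have g: "g = ((g \<bullet> u) / (u \<bullet> u)) *\<^sub>R u"
    by (simp add: w_def)
  have "g \<bullet> u \<le> 0"
    using half[of u] u by (simp add: u_def)
  moreover have "g \<bullet> u \<noteq> 0"
    using g \<open>g \<noteq> 0\<close> by auto
  ultimately have "(u \<bullet> u) / (g \<bullet> u) < 0" "u = ((u \<bullet> u) / (g \<bullet> u)) *\<^sub>R g"
    using u arg_cong[OF g, of "\<lambda>x. ((u \<bullet> u) / (g \<bullet> u)) *\<^sub>R x"]
    by (auto simp: divide_less_0_iff)
  then show thesis
    using that by (simp add: u_def)
qed

text \<open>The open ball about \<open>z\<close> through \<open>q\<close> does not cross the
  frontier, so it lies entirely on the side of \<open>z\<close>. The multiplier rule is applied to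
  \<open>r\<close> for \<open>z\<close> inside and to \<open>- r\<close> for \<open>z\<close>
  outside, which gives \<open>\<mu>\<close> the sign of the signed distance.\<close>

lemma signed_distance_via_multiplier:
  fixes q z :: "complex ^ 'n"
  assumes "open \<Omega>" "open U" "q \<in> U" "q \<in> frontier \<Omega>"
    and \<Omega>: "U \<inter> \<Omega> = {y \<in> U. r y < 0}"
    and r: "(r has_derivative (\<lambda>h. g \<bullet> h)) (at q)" "g \<noteq> 0"
    and near: "infdist z (frontier \<Omega>) = dist z q"
    and "r q = 0"
  obtains \<mu> where "z - q = \<mu> *\<^sub>R g" "signed_distance \<Omega> z = \<mu> * norm g"
proof (cases "z = q")
  case True
  with that[of 0] near show thesis
    by (simp add: signed_distance_def)
next
  case False
  have side: "y \<in> \<Omega> \<longleftrightarrow> z \<in> \<Omega>" if "dist z y < dist z q" for y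
    using infdist_frontier_le[of y \<Omega> z] infdist_nonneg[of y "frontier \<Omega>"] that near
    by (auto simp: dist_commute)
  show thesis
  proof (cases "z \<in> \<Omega>")
    case True
    have "r y \<le> 0" if "y \<in> U" "dist z y < dist z q" for y
    proof -
      have "y \<in> U \<inter> \<Omega>"
        using side[OF that(2)] True that(1) by blast
      then show ?thesis
        unfolding \<Omega> by simp
    qed
    then obtain \<mu> where \<mu>: "\<mu> < 0" "z - q = \<mu> *\<^sub>R g"
      using nearest_point_multiplier[OF r(1) \<open>r q = 0\<close> assms(2,3) r(2) False] by blast
    show thesis
      using that[OF \<mu>(2)] \<mu> True near by (simp add: signed_distance_def dist_norm)
  next
    case outside: False
    have "- r y \<le> 0" if "y \<in> U" "dist z y < dist z q" for y
    proof -
      have "y \<notin> U \<inter> \<Omega>"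
        using side[OF that(2)] outside by blast
      then show ?thesis
        unfolding \<Omega> using that(1) by simp
    qed
    moreover have "((\<lambda>y. - r y) has_derivative (\<lambda>h. (- g) \<bullet> h)) (at q)"
      using has_derivative_minus[OF r(1)] by simp
    ultimately obtain \<mu> where \<mu>: "\<mu> < 0" "z - q = \<mu> *\<^sub>R (- g)"
      using nearest_point_multiplier[of "\<lambda>y. - r y" "- g" q U z] assms False by auto
    show thesis
      using that[of "- \<mu>"] \<mu> outside near by (simp add: signed_distance_def dist_norm)
  qed
qed

section \<open>Inverses of a continuous family of linear maps\<close>

text \<open>The difference \<open>d\<close> of the preimages of \<open>v\<close> under
  \<open>L y\<close> and \<open>L x\<close> satisfies \<open>L y d = (L x - L y) w\<close>. Near
  \<open>x\<close> the maps \<open>L y\<close> are bounded below by \<open>B / 2\<close>, half the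
  lower bound of \<open>L x\<close>, so \<open>d\<close> tends to 0 with
  \<open>L y - L x\<close>.\<close>

lemma continuous_on_inv_blinfun:
  fixes L :: "'a::topological_space \<Rightarrow> ('b::euclidean_space \<Rightarrow>\<^sub>L 'b)"
  assumes L: "continuous_on S L" and bij: "\<And>x. x \<in> S \<Longrightarrow> bij (blinfun_apply (L x))"
  shows "continuous_on S (\<lambda>x. inv (blinfun_apply (L x)) v)"
  unfolding continuous_on_def
proof
  fix x assume "x \<in> S"
  obtain B where "B > 0" and B: "\<And>w. norm w * B \<le> norm (L x w)"
    using linear_inj_bounded_below_pos[of "blinfun_apply (L x)"] bij[OF \<open>x \<in> S\<close>]
    by (metis bij_is_inj blinfun.bounded_linear_right bounded_linear.linear mult.commute)
  define w where "w = inv (blinfun_apply (L x)) v"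
  have inv: "L y (inv (blinfun_apply (L y)) v) = v" if "y \<in> S" for y
    using bij[OF that] by (simp add: bij_is_surj surj_f_inv_f)
  have "((\<lambda>y. L y - L x) \<longlongrightarrow> 0) (at x within S)"
    using L \<open>x \<in> S\<close> by (simp add: continuous_on_def LIM_zero)
  then have conv: "((\<lambda>y. norm (L y - L x)) \<longlongrightarrow> 0) (at x within S)"
    by (rule tendsto_norm_zero)
  then have small: "\<forall>\<^sub>F y in at x within S. norm (L y - L x) < B / 2"
    by (rule order_tendstoD) (use \<open>B > 0\<close> in auto)
  have mem: "\<forall>\<^sub>F y in at x within S. y \<in> S"
    by (simp add: eventually_at_filter)
  have "((\<lambda>y. inv (blinfun_apply (L y)) v - w) \<longlongrightarrow> 0) (at x within S)"
  proof (rule Lim_null_comparison)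
    show "\<forall>\<^sub>F y in at x within S. norm (inv (blinfun_apply (L y)) v - w)
        \<le> norm (L y - L x) * (2 / B * norm w)"
      using small mem
    proof eventually_elim
      case (elim y)
      define d where "d = inv (blinfun_apply (L y)) v - w"
      have "L y d = (L x - L y) w"
        using inv[OF elim(2)] inv[OF \<open>x \<in> S\<close>] by (simp add: d_def w_def blinfun.diff_left blinfun.diff_right)
      then have "norm (L y d) \<le> norm (L y - L x) * norm w"
        using norm_blinfun[of "L x - L y" w] by (simp add: norm_minus_commute)
      moreover have "norm (L x d) \<le> norm (L y d) + norm ((L y - L x) d)"
        using norm_triangle_sub[of "L x d" "L y d"] by (simp add: blinfun.diff_left norm_minus_commute)
      moreover have "norm ((L y - L x) d) \<le> B / 2 * norm d"
        using norm_blinfun[of "L y - L x" d] elim(1)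
        by (smt (verit) mult_right_mono norm_ge_zero)
      ultimately have "B / 2 * norm d \<le> norm (L y - L x) * norm w"
        using B[of d] by (simp add: mult.commute)
      then show ?case
        using \<open>B > 0\<close> by (simp add: d_def field_simps)
    qed
    show "((\<lambda>y. norm (L y - L x) * (2 / B * norm w)) \<longlongrightarrow> 0) (at x within S)"
      using tendsto_mult_left_zero[OF conv] .
  qed
  then show "((\<lambda>x. inv (blinfun_apply (L x)) v) \<longlongrightarrow> inv (blinfun_apply (L x)) v) (at x within S)"
    unfolding w_def by (rule LIM_zero_cancel)
qed

section \<open>Regularity of the signed distance near the boundary\<close>

text \<open>A C^2 condition with named derivatives, so that the real Hessian is
  \<open>n' z h \<bullet> h\<close>. Continuity is asked one direction at a time, as in
  \<open>Ck_on\<close>; in finite dimension this amounts to continuity of \<open>n'\<close>.\<close>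

definition C2_gradient_on :: "('a::real_inner \<Rightarrow> real) \<Rightarrow> ('a \<Rightarrow> 'a) \<Rightarrow> ('a \<Rightarrow> 'a \<Rightarrow> 'a) \<Rightarrow> 'a set \<Rightarrow> bool"
  where "C2_gradient_on f n n' W \<longleftrightarrow>
    (\<forall>z\<in>W. (f has_derivative (\<lambda>h. n z \<bullet> h)) (at z) \<and> (n has_derivative n' z) (at z)) \<and>
    (\<forall>h. continuous_on W (\<lambda>z. n' z h))"

lemma C2_gradient_onD:
  assumes "C2_gradient_on f n n' W"
  shows "z \<in> W \<Longrightarrow> (f has_derivative (\<lambda>h. n z \<bullet> h)) (at z)"
    and "z \<in> W \<Longrightarrow> (n has_derivative n' z) (at z)"
    and "continuous_on W (\<lambda>z. n' z h)"
  using assms by (auto simp: C2_gradient_on_def)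

text \<open>Continuity of \<open>g'\<close> is available only in fixed directions, so the moving
  direction \<open>Y z\<close> is expanded in the basis.\<close>

lemma continuous_on_C2_gradient_apply:
  fixes r :: "'a::euclidean_space \<Rightarrow> real"
  assumes C2: "C2_gradient_on r g g' U" and X: "continuous_on W X" and Y: "continuous_on W Y"
    and XU: "\<And>z. z \<in> W \<Longrightarrow> X z \<in> U"
  shows "continuous_on W (\<lambda>z. g' (X z) (Y z))"
proof (rule continuous_on_eq)
  show "continuous_on W (\<lambda>z. \<Sum>b\<in>Basis. (Y z \<bullet> b) *\<^sub>R g' (X z) b)"
    using XU by (intro continuous_intros Y continuous_on_compose2[OF C2_gradient_onD(3)[OF C2] X]) auto
  show "(\<Sum>b\<in>Basis. (Y z \<bullet> b) *\<^sub>R g' (X z) b) = g' (X z) (Y z)" if "z \<in> W" for z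
  proof -
    have "linear (g' (X z))"
      using C2_gradient_onD(2)[OF C2 XU[OF that]] has_derivative_linear by blast
    from linear_sum[OF this, of "\<lambda>b. (Y z \<bullet> b) *\<^sub>R b" Basis] show ?thesis
      using \<open>linear (g' (X z))\<close> by (simp add: euclidean_representation linear_scale)
  qed
qed

text \<open>The inverse of \<open>G\<close> on the slice with second component 0: \<open>X z\<close>
  is the foot point on the boundary and \<open>\<Lambda> z\<close> the multiplier of the normal. The
  uniqueness clause on \<open>A\<close> later identifies a nearest point with \<open>X z\<close>.
  Continuity is recorded for \<open>X'\<close> because the gradient of the distance depends on
  \<open>z\<close> through \<open>X\<close> alone.\<close>

lemma frontier_normal_coordinates:
  fixes g :: "'a::euclidean_space \<Rightarrow> 'a"
  assumes "open U" "p \<in> U" "r p = 0" "g p \<noteq> 0"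
    and C2: "C2_gradient_on r g g' U"
  obtains A W X \<Lambda> X' \<Lambda>' where "open A" "(p, 0) \<in> A" "open W" "p \<in> W"
    "\<forall>z\<in>W. X z \<in> U \<and> r (X z) = (0::real) \<and> X z + \<Lambda> z *\<^sub>R g (X z) = z"
    "\<forall>z\<in>W. \<forall>q \<mu>. (q, \<mu>) \<in> A \<and> r q = 0 \<and> q + \<mu> *\<^sub>R g q = z \<longrightarrow> q = X z \<and> \<mu> = \<Lambda> z"
    "\<forall>z\<in>W. (X has_derivative X' z) (at z) \<and> (\<Lambda> has_derivative \<Lambda>' z) (at z)"
    "\<forall>h. continuous_on W (\<lambda>z. X' z h)"
proof -
  note r = C2_gradient_onD(1)[OF C2] and g = C2_gradient_onD(2)[OF C2]
  define G where "G y = (fst y + snd y *\<^sub>R g (fst y), r (fst y))" for y :: "'a \<times> real"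
  define F where "F y = Blinfun (\<lambda>k. (fst k + snd y *\<^sub>R g' (fst y) (fst k) + snd k *\<^sub>R g (fst y),
      g (fst y) \<bullet> fst k))" for y :: "'a \<times> real"
  have F: "blinfun_apply (F y) = (\<lambda>k. (fst k + snd y *\<^sub>R g' (fst y) (fst k) + snd k *\<^sub>R g (fst y),
      g (fst y) \<bullet> fst k))" if "y \<in> U \<times> UNIV" for y
    unfolding F_def using that
    by (intro bounded_linear_Blinfun_apply bounded_linear_Pair bounded_linear_add
        bounded_linear_scaleR_left bounded_linear_fst
        bounded_linear_compose[OF bounded_linear_scaleR_left bounded_linear_snd]
        bounded_linear_compose[OF bounded_linear_inner_right bounded_linear_fst]
        bounded_linear_compose[OF bounded_linear_scaleR_right]
        bounded_linear_compose[OF has_derivative_bounded_linear[OF g] bounded_linear_fst]) auto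
  have G: "(G has_derivative blinfun_apply (F y)) (at y)" if "y \<in> U \<times> UNIV" for y
  proof -
    have y: "fst y \<in> U"
      using that by auto
    have "((\<lambda>y. g (fst y)) has_derivative (\<lambda>k. g' (fst y) (fst k))) (at y)"
      using has_derivative_compose[OF has_derivative_fst[OF has_derivative_ident] g[OF y]] .
    moreover have "((\<lambda>y. r (fst y)) has_derivative (\<lambda>k. g (fst y) \<bullet> fst k)) (at y)"
      using has_derivative_compose[OF has_derivative_fst[OF has_derivative_ident] r[OF y]] .
    ultimately show ?thesis
      unfolding G_def F[OF that]
      by (auto intro!: derivative_eq_intros)
  qed
  have contg: "continuous_on U g"
    using g has_derivative_continuous continuous_at_imp_continuous_on by blast
  have contF: "continuous_on (U \<times> UNIV) F"
  proof (rule continuous_on_blinfun_componentwise)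
    fix i :: "'a \<times> real"
    have "continuous_on (U \<times> UNIV) (\<lambda>y. (fst i + snd y *\<^sub>R g' (fst y) (fst i) + snd i *\<^sub>R g (fst y),
        g (fst y) \<bullet> fst i))"
      by (intro continuous_intros continuous_on_C2_gradient_apply[OF C2]
          continuous_on_compose2[OF contg]) auto
    then show "continuous_on (U \<times> UNIV) (\<lambda>y. F y i)"
      by (rule continuous_on_eq) (simp add: F)
  qed
  define c where "c = g p \<bullet> g p"
  have c: "c \<noteq> 0"
    using \<open>g p \<noteq> 0\<close> by (simp add: c_def)
  \<comment> \<open>The inverse of \<open>F (p, 0)\<close>: pairing the first component of an image
    with \<open>g p\<close> and subtracting the second leaves \<open>c\<close> times the multiplier
    direction.\<close>
  define I where "I = (\<lambda>k::'a \<times> real. (fst k - ((g p \<bullet> fst k - snd k) / c) *\<^sub>R g p, (g p \<bullet> fst k - snd k) / c))"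
  have "bounded_linear I"
    unfolding I_def linear_conv_bounded_linear[symmetric]
    by (rule linearI) (auto simp: inner_add_right algebra_simps add_divide_distrib diff_divide_distrib)
  then have "Blinfun I o\<^sub>L F (p, 0) = id_blinfun"
    using c by (intro blinfun_eqI)
      (auto simp: bounded_linear_Blinfun_apply F \<open>p \<in> U\<close> I_def inner_add_right c_def[symmetric])
  moreover have "open (U \<times> (UNIV :: real set))"
    using \<open>open U\<close> by (simp add: open_Times)
  ultimately obtain A V k k' where A: "open A" "A \<subseteq> U \<times> UNIV" "(p, 0) \<in> A"
    and V: "open V" "G (p, 0) \<in> V" and hom: "homeomorphism A V G k"
    and k: "\<And>y. y \<in> V \<Longrightarrow> (k has_derivative k' y) (at y)"
    and k': "\<And>y. y \<in> V \<Longrightarrow> k' y = inv (blinfun_apply (F (k y)))"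
    and bij: "\<And>y. y \<in> V \<Longrightarrow> bij (blinfun_apply (F (k y)))"
    using inverse_function_theorem[of "U \<times> UNIV" G F "(p, 0)" "Blinfun I"] G contF \<open>p \<in> U\<close>
    by (metis (no_types, lifting) UNIV_I mem_Sigma_iff)
  define W where "W = (\<lambda>z. (z, 0::real)) -` V"
  define X where "X z = fst (k (z, 0))" for z
  define \<Lambda> where "\<Lambda> z = snd (k (z, 0))" for z
  have kA: "k (z, 0) \<in> A" "G (k (z, 0)) = (z, 0)" if "z \<in> W" for z
    using that hom by (auto simp: W_def homeomorphism_def)
  have lift: "((\<lambda>z. k (z, 0)) has_derivative (\<lambda>h. k' (z, 0) (h, 0))) (at z)" if "z \<in> W" for z
  proof -
    have "((\<lambda>z. (z, 0::real)) has_derivative (\<lambda>h. (h, 0))) (at z)"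
      by (auto intro!: derivative_eq_intros)
    moreover have "(k has_derivative k' (z, 0)) (at (z, 0))"
      using k that by (simp add: W_def)
    ultimately show ?thesis
      by (rule has_derivative_compose)
  qed
  show thesis
  proof (rule that[of A W X \<Lambda> "\<lambda>z h. fst (k' (z, 0) (h, 0))" "\<lambda>z h. snd (k' (z, 0) (h, 0))"])
    show "open A" "(p, 0) \<in> A" by fact+
    show "open W"
      unfolding W_def by (intro open_vimage V continuous_intros)
    show "p \<in> W"
      using V \<open>r p = 0\<close> by (simp add: W_def G_def)
    show "\<forall>z\<in>W. X z \<in> U \<and> r (X z) = 0 \<and> X z + \<Lambda> z *\<^sub>R g (X z) = z"
    proof
      fix z assume "z \<in> W"
      then show "X z \<in> U \<and> r (X z) = 0 \<and> X z + \<Lambda> z *\<^sub>R g (X z) = z"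
        using kA[of z] A(2) by (auto simp: G_def X_def \<Lambda>_def)
    qed
    show "\<forall>z\<in>W. \<forall>q \<mu>. (q, \<mu>) \<in> A \<and> r q = 0 \<and> q + \<mu> *\<^sub>R g q = z \<longrightarrow> q = X z \<and> \<mu> = \<Lambda> z"
    proof (intro ballI allI impI)
      fix z q \<mu>
      assume *: "(q, \<mu>) \<in> A \<and> r q = 0 \<and> q + \<mu> *\<^sub>R g q = z"
      then have "k (G (q, \<mu>)) = (q, \<mu>)"
        using hom by (simp add: homeomorphism_def)
      moreover have "G (q, \<mu>) = (z, 0)"
        using * by (simp add: G_def)
      ultimately show "q = X z \<and> \<mu> = \<Lambda> z"
        by (simp add: X_def \<Lambda>_def)
    qed
    show "\<forall>z\<in>W. (X has_derivative (\<lambda>h. fst (k' (z, 0) (h, 0)))) (at z) \<and>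
        (\<Lambda> has_derivative (\<lambda>h. snd (k' (z, 0) (h, 0)))) (at z)"
      unfolding X_def \<Lambda>_def by (intro ballI conjI has_derivative_fst has_derivative_snd lift)
    have "continuous_on W (\<lambda>z. k (z, 0))"
      using lift has_derivative_continuous continuous_at_imp_continuous_on by blast
    then have "continuous_on W (\<lambda>z. F (k (z, 0)))"
      by (rule continuous_on_compose2[OF contF]) (use kA(1) A(2) in blast)
    then have "continuous_on W (\<lambda>z. inv (blinfun_apply (F (k (z, 0)))) (h, 0))" for h
      by (rule continuous_on_inv_blinfun) (use bij in \<open>simp add: W_def\<close>)
    then have "continuous_on W (\<lambda>z. k' (z, 0) (h, 0))" for h
      by (rule continuous_on_eq) (simp add: W_def k')
    then show "\<forall>h. continuous_on W (\<lambda>z. fst (k' (z, 0) (h, 0)))"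
      by (intro allI continuous_on_fst)
  qed
qed

text \<open>Radial variation leaves the direction unchanged, so the derivative is the projection
  orthogonal to \<open>v\<close>, scaled by the inverse of the norm.\<close>

lemma has_derivative_sgn:
  fixes v :: "'a::real_inner"
  assumes "v \<noteq> 0"
  shows "(sgn has_derivative (\<lambda>w. (w - (sgn v \<bullet> w) *\<^sub>R sgn v) /\<^sub>R norm v)) (at v)"
proof -
  have "((\<lambda>x::'a. x /\<^sub>R norm x) has_derivative (\<lambda>w. (w - (sgn v \<bullet> w) *\<^sub>R sgn v) /\<^sub>R norm v)) (at v)"
    using assms by (auto intro!: derivative_eq_intros has_derivative_norm simp: fun_eq_iff sgn_div_norm inner_commute algebra_simps)
  then show ?thesis
    by (simp add: sgn_div_norm[abs_def])
qed

text \<open>The point \<open>q\<close> is outside the open set \<open>\<Omega>\<close>, hence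
  \<open>r q\<close> is not negative; if it were positive, \<open>r\<close> would be positive near
  \<open>q\<close> and \<open>q\<close> would not be in the closure.\<close>

lemma frontier_imp_defining_function_zero:
  fixes r :: "'a::t2_space \<Rightarrow> real"
  assumes "open \<Omega>" "open U" "U \<inter> \<Omega> = {y \<in> U. r y < 0}"
    and "q \<in> U" "q \<in> frontier \<Omega>" "isCont r q"
  shows "r q = 0"
proof (rule ccontr)
  assume "r q \<noteq> 0"
  have "q \<notin> \<Omega>"
    using \<open>open \<Omega>\<close> \<open>q \<in> frontier \<Omega>\<close> by (simp add: frontier_def interior_open)
  then have "r q > 0"
    using assms(3,4) \<open>r q \<noteq> 0\<close> by (metis (mono_tags, lifting) Int_iff linorder_neqE mem_Collect_eq)
  then have "\<forall>\<^sub>F y in nhds q. r y > 0"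
    using \<open>isCont r q\<close> by (auto simp: isCont_def tendsto_at_iff_tendsto_nhds intro: order_tendstoD(1))
  then obtain T where T: "open T" "q \<in> T" "\<And>y. y \<in> T \<Longrightarrow> r y > 0"
    by (auto simp: eventually_nhds)
  have "y \<notin> \<Omega>" if "y \<in> T \<inter> U" for y
  proof
    assume "y \<in> \<Omega>"
    then have "y \<in> {y \<in> U. r y < 0}"
      unfolding assms(3)[symmetric] using that by blast
    then show False
      using T(3)[of y] that by auto
  qed
  then have "(T \<inter> U) \<inter> closure \<Omega> = {}"
    using T \<open>open U\<close> by (subst open_Int_closure_eq_empty) auto
  then show False
    using T \<open>q \<in> U\<close> \<open>q \<in> frontier \<Omega>\<close> by (auto simp: frontier_def)
qed

text \<open>The formula \<open>\<Lambda> z * norm (g (X z))\<close> is only visibly C^1. The missing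
  derivative is gained because its gradient, \<open>sgn (g (X z))\<close>, contains no derivative of
  \<open>X\<close> or \<open>\<Lambda>\<close> and is therefore C^1 itself.\<close>

lemma signed_distance_C2_near_frontier_point:
  fixes \<Omega> :: "(complex ^ 'n) set"
  assumes "open \<Omega>" "open U" "p \<in> U" "p \<in> frontier \<Omega>"
    and \<Omega>: "U \<inter> \<Omega> = {y \<in> U. r y < 0}"
    and C2: "C2_gradient_on r g g' U"
    and g0: "\<And>x. x \<in> U \<Longrightarrow> g x \<noteq> 0"
  obtains W n n' where "open W" "p \<in> W" "C2_gradient_on (signed_distance \<Omega>) n n' W"
proof -
  note r = C2_gradient_onD(1)[OF C2] and g = C2_gradient_onD(2)[OF C2]
  have r0: "r q = 0" if "q \<in> U" "q \<in> frontier \<Omega>" for q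
    using frontier_imp_defining_function_zero[OF assms(1,2) \<Omega> that] r[OF that(1)] has_derivative_continuous
    by blast
  have contg: "continuous_on U g"
    using g has_derivative_continuous continuous_at_imp_continuous_on by blast
  obtain A W0 X \<Lambda> X' \<Lambda>' where A: "open A" "(p, 0) \<in> A" and W0: "open W0" "p \<in> W0"
    and X: "\<forall>z\<in>W0. X z \<in> U \<and> r (X z) = 0 \<and> X z + \<Lambda> z *\<^sub>R g (X z) = z"
    and uniq: "\<forall>z\<in>W0. \<forall>q \<mu>. (q, \<mu>) \<in> A \<and> r q = 0 \<and> q + \<mu> *\<^sub>R g q = z \<longrightarrow> q = X z \<and> \<mu> = \<Lambda> z"
    and XL: "\<forall>z\<in>W0. (X has_derivative X' z) (at z) \<and> (\<Lambda> has_derivative \<Lambda>' z) (at z)"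
    and contX': "\<forall>h. continuous_on W0 (\<lambda>z. X' z h)"
    using frontier_normal_coordinates[OF assms(2,3) r0[OF assms(3,4)] g0[OF assms(3)] C2] .
  note X' = XL[THEN bspec, THEN conjunct1] and \<Lambda>' = XL[THEN bspec, THEN conjunct2]
  obtain A1 B1 where AB: "open A1" "open B1" "p \<in> A1" "(0::real) \<in> B1" "A1 \<times> B1 \<subseteq> A"
    using A by (rule open_prod_elim) auto
  obtain d where d: "d > 0" "ball 0 d \<subseteq> B1"
    using AB openE by blast
  \<comment> \<open>A lower bound for the norm of \<open>g\<close> near \<open>p\<close>, which
    turns smallness of \<open>dist z q\<close> into smallness of the multiplier.\<close>
  define m where "m = norm (g p) / 2"
  have m: "m > 0" "m < norm (g p)"
    using g0[OF assms(3)] by (auto simp: m_def)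
  define N where "N = {x \<in> U. m < norm (g x)} \<inter> A1"
  have "open {x \<in> U. m < norm (g x)}"
  proof -
    have "{x \<in> U. m < norm (g x)} = U \<inter> (\<lambda>x. norm (g x)) -` {m<..}"
      by auto
    then show ?thesis
      using continuous_open_preimage[OF continuous_on_norm[OF contg] \<open>open U\<close> open_greaterThan] by simp
  qed
  then have "open N"
    using AB by (auto simp: N_def)
  moreover have "p \<in> N"
    using AB m assms(3) by (auto simp: N_def)
  ultimately obtain e0 where e0: "e0 > 0" "ball p e0 \<subseteq> N"
    using openE by blast
  \<comment> \<open>A nearest point \<open>q\<close> is within \<open>e\<close> of \<open>z\<close>,
    hence within \<open>2 * e\<close> of \<open>p\<close>, so the first bound puts it in
    \<open>N\<close>; the second keeps its multiplier in \<open>ball 0 d\<close>. Together they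
    place \<open>(q, \<mu>)\<close> in \<open>A\<close>.\<close>
  define e where "e = min (e0 / 2) (m * d)"
  have e: "e > 0" "2 * e \<le> e0" "e \<le> m * d"
    using e0 m d by (auto simp: e_def)
  define W where "W = W0 \<inter> ball p e"
  have dist_eq: "signed_distance \<Omega> z = \<Lambda> z * norm (g (X z))" if z: "z \<in> W" for z
  proof -
    obtain q where q: "q \<in> frontier \<Omega>" "infdist z (frontier \<Omega>) = dist z q"
      using infdist_attains_inf[of "frontier \<Omega>" z] assms(4) by auto
    have "dist z q \<le> dist z p"
      using infdist_le[OF assms(4), of z] q by simp
    then have zq: "dist z q < e"
      using z by (simp add: W_def dist_commute)
    have "dist p q < e0"
      using dist_triangle[of p q z] zq z e by (simp add: W_def)
    then have qN: "q \<in> U" "m < norm (g q)" "q \<in> A1"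
      using e0 by (auto simp: N_def)
    obtain \<mu> where \<mu>: "z - q = \<mu> *\<^sub>R g q" "signed_distance \<Omega> z = \<mu> * norm (g q)"
      using signed_distance_via_multiplier[OF assms(1,2) qN(1) q(1) \<Omega> r[OF qN(1)] g0[OF qN(1)] q(2) r0[OF qN(1) q(1)]] .
    have "\<bar>\<mu>\<bar> * m \<le> \<bar>\<mu>\<bar> * norm (g q)"
      using qN by (intro mult_left_mono) auto
    also have "\<dots> = dist z q"
      by (simp add: dist_norm \<mu>(1))
    also have "\<dots> < d * m"
      using zq e by (simp add: mult.commute)
    finally have "\<mu> \<in> B1"
      using d m by auto
    then have "(q, \<mu>) \<in> A"
      using AB qN by blast
    then have "q = X z \<and> \<mu> = \<Lambda> z"
      using bspec[OF uniq, of z] z r0[OF qN(1) q(1)] \<mu>(1)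
      by (simp add: W_def algebra_simps)
    then show ?thesis
      using \<mu>(2) by simp
  qed
  have W: "open W" "p \<in> W"
    using W0 e by (auto simp: W_def)
  have WU: "X z \<in> U" "g (X z) \<noteq> 0" if "z \<in> W" for z
    using bspec[OF X, of z] g0 that by (auto simp: W_def)
  have gX: "((\<lambda>z. g (X z)) has_derivative (\<lambda>h. g' (X z) (X' z h))) (at z)" if "z \<in> W" for z
    using has_derivative_compose[OF X' g] WU(1) that by (simp add: W_def)
  have grad: "(signed_distance \<Omega> has_derivative (\<lambda>h. sgn (g (X z)) \<bullet> h)) (at z)" if "z \<in> W" for z
  proof -
    have z: "z \<in> W0"
      using that by (simp add: W_def)
    \<comment> \<open>Since \<open>r\<close> vanishes along \<open>X\<close>, the foot point moves
      tangentially to the boundary.\<close>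
    have "(\<lambda>h. g (X z) \<bullet> X' z h) = (\<lambda>h. 0)"
    proof (rule has_derivative_unique)
      show "((\<lambda>z. r (X z)) has_derivative (\<lambda>h. g (X z) \<bullet> X' z h)) (at z)"
        using has_derivative_compose[OF X'[OF z] r[OF WU(1)[OF that]]] .
      have "((\<lambda>z. 0::real) has_derivative (\<lambda>h. 0)) (at z)"
        by simp
      then show "((\<lambda>z. r (X z)) has_derivative (\<lambda>h. 0)) (at z)"
        by (rule has_derivative_transform_within_open[OF _ W0(1) z]) (use X in simp)
    qed
    then have tangent: "sgn (g (X z)) \<bullet> X' z h = 0" for h
      by (metis inner_scaleR_left mult_zero_right sgn_div_norm)
    have "(\<lambda>h. X' z h + (\<Lambda> z *\<^sub>R g' (X z) (X' z h) + \<Lambda>' z h *\<^sub>R g (X z))) = (\<lambda>h. h)"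
    proof (rule has_derivative_unique)
      show "((\<lambda>z. X z + \<Lambda> z *\<^sub>R g (X z)) has_derivative
          (\<lambda>h. X' z h + (\<Lambda> z *\<^sub>R g' (X z) (X' z h) + \<Lambda>' z h *\<^sub>R g (X z)))) (at z)"
        by (intro derivative_intros X' \<Lambda>' z gX that)
      have "((\<lambda>z. z) has_derivative (\<lambda>h. h)) (at z)"
        by simp
      then show "((\<lambda>z. X z + \<Lambda> z *\<^sub>R g (X z)) has_derivative (\<lambda>h. h)) (at z)"
        by (rule has_derivative_transform_within_open[OF _ W0(1) z]) (use X in simp)
    qed
    from fun_cong[OF this] have h: "X' z h + (\<Lambda> z *\<^sub>R g' (X z) (X' z h) + \<Lambda>' z h *\<^sub>R g (X z)) = h" for h .
    have "sgn (g (X z)) \<bullet> g (X z) = norm (g (X z))"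
      using WU(2)[OF that] by (simp add: sgn_div_norm power2_norm_eq_inner[symmetric] power2_eq_square)
    \<comment> \<open>Pairing the differentiated identity \<open>h\<close> with the unit normal
      removes the tangential term \<open>X' z h\<close>; what remains is the product rule for
      \<open>\<Lambda> z * norm (g (X z))\<close>.\<close>
    then have inner: "sgn (g (X z)) \<bullet> h
        = \<Lambda> z * (sgn (g (X z)) \<bullet> g' (X z) (X' z h)) + \<Lambda>' z h * norm (g (X z))" for h
      using arg_cong[OF h[of h], of "\<lambda>x. sgn (g (X z)) \<bullet> x"] tangent[of h]
      by (simp add: inner_add_right)
    have "((\<lambda>z. norm (g (X z))) has_derivative (\<lambda>h. sgn (g (X z)) \<bullet> g' (X z) (X' z h))) (at z)"
      using has_derivative_compose[OF gX[OF that] has_derivative_norm[OF WU(2)[OF that]]]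
      by (simp add: inner_commute)
    then have "((\<lambda>z. \<Lambda> z * norm (g (X z))) has_derivative
        (\<lambda>h. \<Lambda> z * (sgn (g (X z)) \<bullet> g' (X z) (X' z h)) + \<Lambda>' z h * norm (g (X z)))) (at z)"
      by (intro has_derivative_mult \<Lambda>' z)
    then have "((\<lambda>z. \<Lambda> z * norm (g (X z))) has_derivative (\<lambda>h. sgn (g (X z)) \<bullet> h)) (at z)"
      unfolding inner[symmetric] .
    then show ?thesis
      by (rule has_derivative_transform_within_open[OF _ W(1) that]) (simp add: dist_eq)
  qed
  define n' where "n' z h = (g' (X z) (X' z h)
      - (sgn (g (X z)) \<bullet> g' (X z) (X' z h)) *\<^sub>R sgn (g (X z))) /\<^sub>R norm (g (X z))" for z h
  have "((\<lambda>z. sgn (g (X z))) has_derivative n' z) (at z)" if "z \<in> W" for z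
    using has_derivative_compose[OF gX[OF that] has_derivative_sgn[OF WU(2)[OF that]]]
    by (simp add: n'_def[abs_def])
  moreover have "continuous_on W (\<lambda>z. n' z h)" for h
  proof -
    have XU: "continuous_on W X"
      using X' has_derivative_continuous unfolding W_def
      by (meson IntD1 continuous_at_imp_continuous_on)
    have "continuous_on W (\<lambda>z. X' z h)"
      using contX'[rule_format] by (rule continuous_on_subset) (simp add: W_def)
    then have "continuous_on W (\<lambda>z. g' (X z) (X' z h))"
      using continuous_on_C2_gradient_apply[OF C2 XU] WU(1) by blast
    then show ?thesis
      unfolding n'_def using WU
      by (intro continuous_intros continuous_on_compose2[OF contg XU] continuous_on_sgn) auto
  qed
  ultimately show thesis
    using that[OF W, of "\<lambda>z. sgn (g (X z))" n'] grad by (simp add: C2_gradient_on_def)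
qed

section \<open>Passing between \<open>C2_gradient_on\<close> and \<open>Ck_on\<close>\<close>

lemma C2_gradient_on_imp_Ck_on:
  fixes f :: "'a::euclidean_space \<Rightarrow> real"
  assumes f: "C2_gradient_on f n n' W" and "open W"
  shows "Ck_on 2 f W"
proof -
  note C2 = C2_gradient_onD[OF f]
  have fd: "frechet_derivative f (at x) v = n x \<bullet> v" if "x \<in> W" for x v
    using frechet_derivative_at[OF C2(1)[OF that]] by metis
  have d: "((\<lambda>x. frechet_derivative f (at x) v) has_derivative (\<lambda>h. n' x h \<bullet> v)) (at x)" if "x \<in> W" for x v
    using has_derivative_inner_left[OF C2(2)[OF that], of v]
    by (rule has_derivative_transform_within_open[OF _ \<open>open W\<close> that]) (simp add: fd)
  have "continuous_on W (\<lambda>x. frechet_derivative (\<lambda>x. frechet_derivative f (at x) v) (at x) w)" for v w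
  proof (rule continuous_on_eq)
    show "continuous_on W (\<lambda>x. n' x w \<bullet> v)"
      by (intro continuous_intros C2)
    show "n' x w \<bullet> v = frechet_derivative (\<lambda>x. frechet_derivative f (at x) v) (at x) w" if "x \<in> W" for x
      using frechet_derivative_at[OF d[OF that]] by metis
  qed
  then show ?thesis
    unfolding numeral_2_eq_2 using differentiableI[OF C2(1)] differentiableI[OF d] by simp
qed

lemma Ck_on_subset: "Ck_on k f S \<Longrightarrow> T \<subseteq> S \<Longrightarrow> Ck_on k f T"
  by (induction k arbitrary: f) (auto intro: continuous_on_subset)

text \<open>Local pieces come with separately chosen gradient functions, so they are glued through
  \<open>Ck_on\<close>, which speaks of \<open>f\<close> alone: differentiability is pointwise, and
  continuity is local on open sets.\<close>

lemma Ck_on_Union: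
  "(\<And>W. W \<in> \<W> \<Longrightarrow> open W \<and> Ck_on k f W) \<Longrightarrow> Ck_on k f (\<Union>\<W>)"
  by (induction k arbitrary: f) (auto intro: continuous_on_open_Union)

text \<open>The gradient is assembled from the derivatives along the basis vectors, and its
  derivative from theirs.\<close>

lemma Ck_on_imp_C2_gradient_on:
  fixes r :: "'a::euclidean_space \<Rightarrow> real"
  assumes "Ck_on 2 r U"
  obtains g g' where "C2_gradient_on r g g' U"
proof -
  define D where "D x v = frechet_derivative r (at x) v" for x v
  define E where "E x v = frechet_derivative (\<lambda>x. D x v) (at x)" for x v
  have D: "(r has_derivative D x) (at x)"
    and E: "((\<lambda>x. D x v) has_derivative E x v) (at x)" if "x \<in> U" for x v
    using assms that unfolding D_def[abs_def] E_def[abs_def] numeral_2_eq_2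
    by (auto simp flip: frechet_derivative_works)
  have contE: "continuous_on U (\<lambda>x. E x v h)" for v h
    using assms unfolding D_def[abs_def] E_def[abs_def] numeral_2_eq_2 by auto
  define g where "g x = (\<Sum>b\<in>Basis. D x b *\<^sub>R b)" for x
  have "(r has_derivative (\<lambda>h. g x \<bullet> h)) (at x)" if "x \<in> U" for x
  proof -
    have "D x h = g x \<bullet> h" for h
    proof -
      have "D x h = D x (\<Sum>b\<in>Basis. (h \<bullet> b) *\<^sub>R b)"
        by (simp add: euclidean_representation)
      also have "\<dots> = (\<Sum>b\<in>Basis. (h \<bullet> b) * D x b)"
        using has_derivative_linear[OF D[OF that]] by (simp add: linear_sum linear_scale)
      also have "\<dots> = g x \<bullet> h"
        by (simp add: g_def inner_sum_left inner_commute[of h] mult.commute)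
      finally show ?thesis .
    qed
    then show ?thesis
      using D[OF that] by presburger
  qed
  moreover have "(g has_derivative (\<lambda>h. \<Sum>b\<in>Basis. E x b h *\<^sub>R b)) (at x)" if "x \<in> U" for x
    unfolding g_def using E[OF that] by (auto intro!: derivative_eq_intros)
  moreover have "continuous_on U (\<lambda>x. \<Sum>b\<in>Basis. E x b h *\<^sub>R b)" for h
    by (intro continuous_intros contE)
  ultimately show thesis
    using that[of g "\<lambda>x h. \<Sum>b\<in>Basis. E x b h *\<^sub>R b"] by (simp add: C2_gradient_on_def)
qed

lemma signed_distance_C2_near_frontier:
  fixes \<Omega> :: "(complex ^ 'n) set"
  assumes "smoothly_bounded_domain \<Omega>" "p \<in> frontier \<Omega>"
  obtains W n n' where "open W" "p \<in> W" "C2_gradient_on (signed_distance \<Omega>) n n' W"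
proof -
  obtain U r where "local_defining_function \<Omega> p U r"
    using assms unfolding smoothly_bounded_domain_def by blast
  then have U: "open U" "p \<in> U" "smooth_on r U" "U \<inter> \<Omega> = {z \<in> U. r z < 0}"
    and nz: "\<And>z. z \<in> U \<Longrightarrow> \<exists>k. partial_x k r z \<noteq> 0 \<or> partial_y k r z \<noteq> 0"
    unfolding local_defining_function_def by simp_all
  have "Ck_on 2 r U"
    using U(3) by (simp add: smooth_on_def)
  then obtain g g' where C2: "C2_gradient_on r g g' U"
    by (rule Ck_on_imp_C2_gradient_on)
  have "g x \<noteq> 0" if "x \<in> U" for x
    using nz[OF that] frechet_derivative_at[OF C2_gradient_onD(1)[OF C2 that], symmetric]
    by (auto simp: partial_x_def partial_y_def)
  then obtain W n n' where "open W" "p \<in> W" "C2_gradient_on (signed_distance \<Omega>) n n' W"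
    using signed_distance_C2_near_frontier_point[OF _ U(1,2) assms(2) U(4) C2] assms(1)
    by (metis smoothly_bounded_domain_def)
  then show thesis
    by (rule that)
qed

section \<open>Hessians at boundary points and their comparison with the interior\<close>

text \<open>The kernel of the real differential of one local defining function at \<open>p\<close>
  lies in the real tangent space, and a rotation takes \<open>V\<close> into that kernel.\<close>

lemma exists_rotation_into_real_tangent_space:
  fixes \<Omega> :: "(complex ^ 'n) set"
  assumes "smoothly_bounded_domain \<Omega>" "p \<in> frontier \<Omega>"
  obtains c where "norm c = 1" "c *s V \<in> real_tangent_space \<Omega> p"
proof -
  obtain U r where U: "local_defining_function \<Omega> p U r"
    using assms unfolding smoothly_bounded_domain_def by blast
  then have "Ck_on (Suc 0) r U" "p \<in> U"
    by (auto simp: local_defining_function_def smooth_on_def)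
  then have lin: "linear (frechet_derivative r (at p))"
    by (auto intro: linear_frechet_derivative)
  obtain c where "norm c = 1" "frechet_derivative r (at p) (c *s V) = 0"
    using unit_rotation_into_kernel[OF lin] .
  moreover have "frechet_derivative r (at p) w
      = (\<Sum>k\<in>UNIV. partial_x k r p * Re (w $ k) + partial_y k r p * Im (w $ k))" for w
    by (simp add: linear_vec_expansion[OF lin, of w] partial_x_def partial_y_def mult.commute)
  ultimately show thesis
    using that[of c] U by (auto simp: real_tangent_space_def)
qed

text \<open>The function \<open>f (z + h) - f (q + h)\<close> has a minimum at \<open>h = 0\<close>,
  so its second derivative along \<open>v\<close> is nonnegative there.\<close>

lemma hessian_le_of_translate_le:
  fixes f :: "'a::real_inner \<Rightarrow> real"
  assumes "open W" "z \<in> W" "C2_gradient_on f n n' W"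
    and "open Y" "q \<in> Y" "C2_gradient_on f m m' Y"
    and le: "\<And>h. f (q + h) + c \<le> f (z + h)" and eq: "f q + c = f z"
  shows "m' q v \<bullet> v \<le> n' z v \<bullet> v"
proof -
  define \<phi> where "\<phi> s = f (z + s *\<^sub>R v) - f (q + s *\<^sub>R v)" for s
  define \<phi>' where "\<phi>' s = n (z + s *\<^sub>R v) \<bullet> v - m (q + s *\<^sub>R v) \<bullet> v" for s
  have "\<forall>\<^sub>F s in nhds (0::real). z + s *\<^sub>R v \<in> W \<and> q + s *\<^sub>R v \<in> Y"
  proof (intro eventually_conj)
    have lim: "((\<lambda>s. x + s *\<^sub>R v) \<longlongrightarrow> x + 0 *\<^sub>R v) (nhds 0)" for x
      by (intro tendsto_intros filterlim_ident)
    show "\<forall>\<^sub>F s in nhds (0::real). z + s *\<^sub>R v \<in> W"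
      by (rule topological_tendstoD[OF lim]) (simp_all add: assms)
    show "\<forall>\<^sub>F s in nhds (0::real). q + s *\<^sub>R v \<in> Y"
      by (rule topological_tendstoD[OF lim]) (simp_all add: assms)
  qed
  then obtain e where e: "e > 0" "\<And>s. \<bar>s\<bar> < e \<Longrightarrow> z + s *\<^sub>R v \<in> W \<and> q + s *\<^sub>R v \<in> Y"
    by (auto simp: eventually_nhds_metric)
  have "n' z v \<bullet> v - m' q v \<bullet> v \<ge> 0"
  proof (rule local_min_second_derivative_nonneg[OF \<open>e > 0\<close>, of \<phi> \<phi>'])
    show "(\<phi> has_real_derivative \<phi>' s) (at s)" if "\<bar>s\<bar> < e" for s
      unfolding \<phi>_def \<phi>'_def
      using e(2)[OF that] C2_gradient_onD(1)[OF assms(3)] C2_gradient_onD(1)[OF assms(6)]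
      by (intro DERIV_diff has_real_derivative_along_line) auto
    have "((\<lambda>x. n x \<bullet> v) has_derivative (\<lambda>h. n' z h \<bullet> v)) (at (z + 0 *\<^sub>R v))"
      "((\<lambda>x. m x \<bullet> v) has_derivative (\<lambda>h. m' q h \<bullet> v)) (at (q + 0 *\<^sub>R v))"
      using C2_gradient_onD(2)[OF assms(3,2)] C2_gradient_onD(2)[OF assms(6,5)]
      by (auto intro: has_derivative_inner_left)
    from this[THEN has_real_derivative_along_line]
    show "(\<phi>' has_real_derivative n' z v \<bullet> v - m' q v \<bullet> v) (at 0)"
      unfolding \<phi>'_def by (intro DERIV_diff)
    show "\<phi> 0 \<le> \<phi> s" for s
      using le[of "s *\<^sub>R v"] eq by (simp add: \<phi>_def)
  qed
  then show ?thesis by simp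
qed

section \<open>Plurisubharmonicity\<close>

theorem theorem6p6:
  fixes \<Omega> :: "(complex ^ 'n) set"
  assumes "smoothly_bounded_domain \<Omega>"
    and "\<And>z V. z \<in> frontier \<Omega> \<Longrightarrow> V \<in> real_tangent_space \<Omega> z \<Longrightarrow>
           0 \<le> complex_hessian (signed_distance \<Omega>) z V V"
  shows "\<exists>U. open U \<and> frontier \<Omega> \<subseteq> U \<and>
           plurisubharmonic_on (signed_distance \<Omega>) (U \<inter> \<Omega>)"
proof -
  let ?\<delta> = "signed_distance \<Omega>"
  define \<W> where "\<W> = {W. open W \<and> (\<exists>n n'. C2_gradient_on ?\<delta> n n' W)}"
  define U where "U = \<Union>\<W>"
  have "open U"
    unfolding U_def \<W>_def by blast
  moreover have sub: "frontier \<Omega> \<subseteq> U"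
  proof
    fix p assume p: "p \<in> frontier \<Omega>"
    obtain W n n' where "open W" "p \<in> W" "C2_gradient_on ?\<delta> n n' W"
      using signed_distance_C2_near_frontier[OF assms(1) p] .
    then show "p \<in> U"
      unfolding U_def \<W>_def by blast
  qed
  moreover have "Ck_on 2 ?\<delta> U"
    unfolding U_def \<W>_def by (rule Ck_on_Union) (auto intro: C2_gradient_on_imp_Ck_on)
  then have "Ck_on 2 ?\<delta> (U \<inter> \<Omega>)"
    by (rule Ck_on_subset) simp
  moreover have "0 \<le> complex_hessian ?\<delta> z V V" if z: "z \<in> U \<inter> \<Omega>" for z V
  proof -
    obtain W n n' where W: "open W" "z \<in> W" "C2_gradient_on ?\<delta> n n' W"
      using z unfolding U_def \<W>_def by blast
    have "\<Omega> \<noteq> {}" "bounded \<Omega>"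
      using assms(1) by (auto simp: smoothly_bounded_domain_def)
    \<comment> \<open>A nonempty frontier is what lets the distance be attained at some
      \<open>q\<close>.\<close>
    then have "frontier \<Omega> \<noteq> {}"
      using frontier_eq_empty not_bounded_UNIV by metis
    then obtain q where q: "q \<in> frontier \<Omega>" "infdist z (frontier \<Omega>) = dist z q"
      using infdist_attains_inf[of "frontier \<Omega>" z] by auto
    obtain Y m m' where Y: "open Y" "q \<in> Y" "C2_gradient_on ?\<delta> m m' Y"
      using q(1) sub unfolding U_def \<W>_def by blast
    have \<delta>q: "?\<delta> q = 0"
      using q(1) by (simp add: signed_distance_def)
    have le: "m' q v \<bullet> v \<le> n' z v \<bullet> v" for v
      using hessian_le_of_translate_le[OF W Y, of "?\<delta> z"] signed_distance_translate_ge[OF _ q] z \<delta>q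
      by auto
    obtain c where "norm c = 1" "c *s V \<in> real_tangent_space \<Omega> q"
      using exists_rotation_into_real_tangent_space[OF assms(1) q(1)] .
    then have "0 \<le> complex_hessian ?\<delta> q V V"
      using assms(2)[OF q(1)] complex_hessian_rotate by metis
    then have "0 \<le> m' q V \<bullet> V + m' q (\<i> *s V) \<bullet> (\<i> *s V)"
      using complex_hessian_eq_Complex[OF Y(1,2) C2_gradient_onD(1)[OF Y(3)] C2_gradient_onD(2)[OF Y(3,2)]]
      by (simp add: less_eq_complex_def)
    also have "\<dots> \<le> n' z V \<bullet> V + n' z (\<i> *s V) \<bullet> (\<i> *s V)"
      by (intro add_mono le)
    \<comment> \<open>The order on complex numbers also demands a zero imaginary part, which the
      symmetry of \<open>n' z\<close> supplies.\<close>
    finally show ?thesis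
      using complex_hessian_eq_Complex[OF W(1,2) C2_gradient_onD(1)[OF W(3)] C2_gradient_onD(2)[OF W(3,2)]]
        gradient_derivative_symmetric[OF W(1,2) C2_gradient_onD(1)[OF W(3)] C2_gradient_onD(2)[OF W(3,2)],
          of V "\<i> *s V"]
      by (simp add: less_eq_complex_def)
  qed
  ultimately show ?thesis
    unfolding plurisubharmonic_on_def by blast
qed

end
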